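(* Let $K$ be an algebraically closed field, and let $F,G\in K[[X]]$ have lowest-degree terms of degrees $m,n>1$, respectively, where $\mathrm{char}(K)\nmid mn$. The following are equivalent: (1) the semigroup generated by $F$ and $G$ under composition is not the free semigroup on the letters $F$ and $G$; (2) there is some $L\in K[[X]]$ having lowest-degree term of degree $1$ for which $L^{\langle -1\rangle}\circ F\circ L=X^m$ and $L^{\langle -1\rangle}\circ G\circ L=\alpha X^n$, where $\alpha\in K^*$ is a root of unity.
   Context: For a power series $L\in K[[X]]$ with lowest-degree term of degree $1$, $L^{\langle -1\rangle}$ denotes its inverse under composition. The semigroup generated by $F$ and $G$ under composition consists of all compositions of one or more copies of $F$ and $G$. It "is the free semigroup on the letters $F$ and $G$" if distinct nonempty words in the two letters $F,G$ always give distinct compositions (so it is not free exactly when two distinct words in the letters give the same composition). When $\mathrm{char}(K)=0$, the condition $\mathrm{char}(K)\nmid mn$ is automatically satisfied. *)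

theory Defs
  imports "HOL-Computational_Algebra.Computational_Algebra"
begin

inductive_set comp_semigroup :: "'a::field fps \<Rightarrow> 'a fps \<Rightarrow> 'a fps set"
  for F G :: "'a fps" where
  genF: "F \<in> comp_semigroup F G"
| genG: "G \<in> comp_semigroup F G"
| comp: "A \<in> comp_semigroup F G \<Longrightarrow> B \<in> comp_semigroup F G \<Longrightarrow> A oo B \<in> comp_semigroup F G"

(* The letters are formal symbols, distinct even when the two series coincide:
   for F = G the semigroup is not free on the letters. *)
datatype letter = LF | LG

fun letter_series :: "'a::field fps \<Rightarrow> 'a fps \<Rightarrow> letter \<Rightarrow> 'a fps" where
  "letter_series F G LF = F"
| "letter_series F G LG = G"

(* The word a1 a2 ... ar is sent to the composition a1 o a2 o ... o ar; the final fps_X is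
   the identity for composition. *)
definition comp_word :: "'a::field fps \<Rightarrow> 'a fps \<Rightarrow> letter list \<Rightarrow> 'a fps" where
  "comp_word F G w = foldr (\<lambda>a H. letter_series F G a oo H) w fps_X"

definition free_on_letters :: "'a::field fps \<Rightarrow> 'a fps \<Rightarrow> bool" where
  "free_on_letters F G \<longleftrightarrow> bij_betw (comp_word F G) {w. w \<noteq> []} (comp_semigroup F G)"

lemma comp_word_Nil [simp]: "comp_word F G [] = fps_X"
  and comp_word_Cons [simp]: "comp_word F G (a # w) = letter_series F G a oo comp_word F G w"
  by (simp_all add: comp_word_def)

lemma comp_word_nth_0:
  assumes "F $ 0 = 0" "G $ 0 = 0"
  shows "comp_word F G w $ 0 = 0"
proof (induction w)
  case (Cons a w)
  then show ?case using assms by (cases a) auto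
qed simp

lemma comp_word_append:
  assumes "F $ 0 = 0" "G $ 0 = 0"
  shows "comp_word F G (v @ w) = comp_word F G v oo comp_word F G w"
proof (induction v)
  case Nil
  then show ?case using comp_word_nth_0[OF assms] by simp
next
  case (Cons a v)
  then show ?case using comp_word_nth_0[OF assms] by (simp add: fps_compose_assoc)
qed

lemma comp_semigroup_eq_words:
  assumes "F $ 0 = 0" "G $ 0 = 0"
  shows "comp_semigroup F G = comp_word F G ` {w. w \<noteq> []}"
proof
  show "comp_semigroup F G \<subseteq> comp_word F G ` {w. w \<noteq> []}"
  proof
    fix A assume "A \<in> comp_semigroup F G"
    then show "A \<in> comp_word F G ` {w. w \<noteq> []}"
    proof induction
      case genF
      show ?case by (rule image_eqI[of _ _ "[LF]"]) auto
    next
      case genG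
      show ?case by (rule image_eqI[of _ _ "[LG]"]) auto
    next
      case (comp A B)
      then obtain v w where "v \<noteq> []" "A = comp_word F G v" "w \<noteq> []" "B = comp_word F G w" by auto
      then show ?case
        by (intro image_eqI[of _ _ "v @ w"]) (auto simp: comp_word_append[OF assms])
    qed
  qed
  have letter: "letter_series F G a \<in> comp_semigroup F G" for a
    by (cases a) (auto intro: comp_semigroup.intros)
  have "comp_word F G w \<in> comp_semigroup F G" if "w \<noteq> []" for w
    using that
  proof (induction w rule: list_nonempty_induct)
    case (single a)
    then show ?case using letter by simp
  next
    case (cons a w)
    then show ?case using letter by (auto intro: comp_semigroup.comp)
  qed
  then show "comp_word F G ` {w. w \<noteq> []} \<subseteq> comp_semigroup F G" by auto
qed

lemma free_on_letters_iff:
  assumes "F $ 0 = 0" "G $ 0 = 0"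
  shows "free_on_letters F G \<longleftrightarrow>
    (\<forall>v w. v \<noteq> [] \<and> w \<noteq> [] \<and> v \<noteq> w \<longrightarrow> comp_word F G v \<noteq> comp_word F G w)"
  unfolding free_on_letters_def bij_betw_def
  by (auto simp: comp_semigroup_eq_words[OF assms] inj_on_def)

end

theory Submission
  imports Defs
begin

text \<open>
  Suppose that two distinct words in \<open>F\<close> and \<open>G\<close> agree. Composition can be cancelled on the
  right, so after removing a common suffix one may assume that the words end in different letters:
  \<open>u \<circ> F = v \<circ> G\<close>, where \<open>u\<close> and \<open>v\<close> are words, possibly empty
  (\<open>equal_words_distinct_last_letters\<close>). Call the common value \<open>W\<close>. Its degree \<open>N\<close> (the degree of a
  series is that of its lowest term) is a product of copies of \<open>m\<close> and \<open>n\<close>, so it is not divisible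
  by the characteristic, and in a suitable coordinate \<open>W = X\<^sup>N\<close>; this is the formal version of
  Boettcher's theorem (\<open>bottcher\<close>).

  The heart of the proof is that in this coordinate \<open>F\<close> and \<open>G\<close> are monomials. For a series
  \<open>A = c X\<^sup>d (1 + a X\<^sup>r + \<dots>)\<close> with \<open>a \<noteq> 0\<close>, let the gap be \<open>r\<close>, or \<open>\<infinity>\<close> for a monomial. The gap of
  \<open>A \<circ> B\<close> is at least the minimum of the gap of \<open>B\<close> and \<open>deg B\<close> times the gap of \<open>A\<close>, with equality
  if these two numbers differ, provided that the characteristic does not divide \<open>deg A\<close>: then the
  two next terms cannot cancel, and that of \<open>B\<close> is not lost in the power \<open>B\<close> to the \<open>deg A\<close>. Since \<open>u \<circ> F\<close> has infinite
  gap, the gap of \<open>F\<close> is \<open>m\<close> times that of \<open>u\<close>. But \<open>u\<close> is a word in \<open>F\<close> and \<open>G\<close>, so its gap is at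
  least the smaller of the gaps of \<open>F\<close> and \<open>G\<close>. Hence the gap of \<open>F\<close> is at least \<open>m\<close> times this
  minimum, and that of \<open>G\<close> is at least \<open>n\<close> times this minimum; as \<open>m, n > 1\<close>, the minimum is
  infinite. The proof below runs this as an induction on a lower bound for both gaps
  (\<open>monomial_mod_improve\<close>, \<open>letters_are_monomials\<close>).

  A scaling of the variable turns \<open>F\<close> into \<open>X\<^sup>m\<close> and \<open>G\<close> into \<open>\<alpha> X\<^sup>n\<close>. Every word then is
  \<open>\<alpha>\<^sup>e X\<^sup>d\<close>, and the relation reads \<open>\<alpha>\<^sup>i = \<alpha>\<^sup>j\<close>. Here \<open>i \<noteq> j\<close> for words of equal degree that end in
  different letters (\<open>word_exponent_neq\<close>), so \<open>\<alpha>\<close> is a root of unity.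

  Conversely, if \<open>F = X\<^sup>m\<close> and \<open>G = \<alpha> X\<^sup>n\<close> with \<open>\<alpha>\<^sup>k = 1\<close>, then the \<open>k + 1\<close> words with one letter
  \<open>F\<close> and \<open>k\<close> letters \<open>G\<close> have the same degree and only \<open>k\<close> possible leading coefficients, so two of
  them agree (\<open>root_of_unity_imp_equal_words\<close>).
\<close>

section \<open>Power series modulo powers of the variable\<close>

lemma fps_X_power_dvd_iff:
  fixes f :: "'a::field fps"
  shows "fps_X ^ k dvd f \<longleftrightarrow> (\<forall>i<k. f $ i = 0)"
proof
  assume "fps_X ^ k dvd f"
  then obtain g where "f = fps_X ^ k * g" by (auto elim: dvdE)
  then show "\<forall>i<k. f $ i = 0" by (simp add: fps_X_power_mult_nth)
next
  assume *: "\<forall>i<k. f $ i = 0"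
  have "f = fps_X ^ k * fps_shift k f"
    by (rule fps_ext) (use * in \<open>auto simp: fps_X_power_mult_nth\<close>)
  then show "fps_X ^ k dvd f" by (rule dvdI)
qed

lemma fps_monomial_times_unit:
  fixes A :: "'a::field fps"
  assumes "A \<noteq> 0"
  obtains c \<phi> where "c \<noteq> 0" "A = fps_const c * fps_X ^ subdegree A * \<phi>" "\<phi> $ 0 = 1"
proof -
  define c where "c = A $ subdegree A"
  have c: "c \<noteq> 0" using assms by (simp add: c_def)
  have "A = (fps_const c * fps_const (1 / c)) * (fps_shift (subdegree A) A * fps_X ^ subdegree A)"
    using c by (simp flip: subdegree_decompose)
  also have "\<dots> = fps_const c * fps_X ^ subdegree A * (fps_const (1 / c) * fps_shift (subdegree A) A)"
    by (simp only: mult_ac)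
  finally show thesis using c by (intro that) (auto simp: c_def)
qed

text \<open>
  The iterates of \<open>T\<close> converge coefficientwise, each step fixing one more coefficient. The hypotheses
  fix the constant term because the maps to which this is applied contract only on series with a
  prescribed constant term.
\<close>

lemma fps_contraction_fixed_point:
  fixes T :: "'a::field fps \<Rightarrow> 'a fps"
  assumes T0: "\<And>f. f $ 0 = a \<Longrightarrow> T f $ 0 = a"
    and contr: "\<And>f g k. f $ 0 = a \<Longrightarrow> g $ 0 = a \<Longrightarrow> k > 0 \<Longrightarrow>
      fps_X ^ k dvd f - g \<Longrightarrow> fps_X ^ Suc k dvd T f - T g"
  obtains f where "f $ 0 = a" "T f = f"
proof -
  define s where "s k = (T ^^ k) (fps_const a)" for k
  have sSuc: "s (Suc k) = T (s k)" for k by (simp add: s_def)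
  have s0: "s k $ 0 = a" for k
    by (induction k) (simp_all add: sSuc T0, simp add: s_def)
  have step: "fps_X ^ Suc k dvd s (Suc k) - s k" for k
  proof (induction k)
    case 0
    show ?case using s0[of 0] s0[of 1] by (simp add: fps_X_power_dvd_iff[of 1, simplified])
  next
    case (Suc k)
    then show ?case using contr[OF s0[of "Suc k"] s0[of k], of "Suc k"] by (simp add: sSuc)
  qed
  have stable: "s j $ i = s i $ i" if "i \<le> j" for i j
    using that
  proof (induction j rule: dec_induct)
    case (step j)
    have "s (Suc j) $ i = s j $ i"
      using \<open>fps_X ^ Suc j dvd s (Suc j) - s j\<close> step.hyps
      unfolding fps_X_power_dvd_iff by auto
    then show ?case using step.IH by simp
  qed simp
  define f where "f = Abs_fps (\<lambda>i. s i $ i)"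
  have f0: "f $ 0 = a" by (simp add: f_def s0)
  have approx: "fps_X ^ Suc k dvd f - s k" for k
    unfolding fps_X_power_dvd_iff using stable[of _ k] by (auto simp: f_def)
  have "T f = f"
  proof (rule fps_ext)
    fix i
    have "fps_X ^ Suc (Suc i) dvd T f - T (s i)"
      using approx[of i] by (intro contr f0 s0) auto
    then have "T f $ i = s (Suc i) $ i"
      unfolding fps_X_power_dvd_iff sSuc by simp
    then show "T f $ i = f $ i" using stable[of i "Suc i"] by (simp add: f_def)
  qed
  with f0 show thesis by (rule that)
qed

lemma power_fps_X_dvd_compose:
  fixes f W :: "'a::field fps"
  assumes "fps_X ^ d dvd W" "d > 0" "fps_X ^ k dvd f"
  shows "fps_X ^ (d * k) dvd f oo W"
proof -
  have W0: "W $ 0 = 0" using assms(1,2) by (simp add: fps_X_power_dvd_iff)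
  obtain q where "f = fps_X ^ k * q" using assms(3) by (auto elim: dvdE)
  then have "f oo W = W ^ k * (q oo W)"
    using W0 by (simp add: fps_compose_mult_distrib fps_compose_power[symmetric])
  moreover have "fps_X ^ (d * k) dvd W ^ k"
    unfolding power_mult using assms(1) by (rule dvd_power_same)
  ultimately show ?thesis by simp
qed

section \<open>Boettcher coordinates\<close>

text \<open>
  The Boettcher equation after division by the leading monomials. It is solved without first extracting an
  \<open>N\<close>-th root, as a fixed point of a Newton step with the fixed slope \<open>N\<close>, the derivative of \<open>\<beta> \<mapsto> \<beta>\<^sup>N\<close> at \<open>\<beta> = 1\<close>. The term \<open>\<beta> \<circ> W\<close> does no harm to
  the contraction: since \<open>W\<close> has degree at least \<open>2\<close>, composition with it raises the order of a difference.
\<close>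

lemma bottcher_unit_equation:
  fixes w W :: "'a::field fps"
  assumes "of_nat N \<noteq> (0::'a)" "w $ 0 = 1" "fps_X ^ 2 dvd W"
  obtains \<beta> where "\<beta> $ 0 = 1" "\<beta> ^ N = w * (\<beta> oo W)"
proof -
  define c where "c = fps_const (1 / of_nat N :: 'a)"
  define T where "T \<beta> = \<beta> - c * (\<beta> ^ N - w * (\<beta> oo W))" for \<beta>
  obtain \<beta> where \<beta>: "\<beta> $ 0 = 1" "T \<beta> = \<beta>"
  proof (rule fps_contraction_fixed_point[of 1 T])
    show "T f $ 0 = 1" if "f $ 0 = 1" for f
      using that assms(2) by (simp add: T_def fps_nth_power_0)
  next
    fix f g :: "'a fps" and k :: nat
    assume f0: "f $ 0 = 1" and g0: "g $ 0 = 1" and k: "k > 0" and dvd: "fps_X ^ k dvd f - g"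
    define S where "S = (\<Sum>i<N. g ^ (N - Suc i) * f ^ i)"
    have "S $ 0 = of_nat N"
      by (simp add: S_def fps_sum_nth f0 g0 fps_nth_power_0)
    then have "(1 - c * S) $ 0 = 0" using assms(1) by (simp add: c_def)
    then have "fps_X ^ 1 dvd 1 - c * S"
      unfolding fps_X_power_dvd_iff by simp
    with dvd have "fps_X ^ k * fps_X ^ 1 dvd (f - g) * (1 - c * S)" by (rule mult_dvd_mono)
    then have 1: "fps_X ^ Suc k dvd (f - g) * (1 - c * S)" by (simp add: mult.commute)
    have "fps_X ^ (2 * k) dvd (f - g) oo W"
      using assms(3) dvd by (intro power_fps_X_dvd_compose) auto
    moreover have "fps_X ^ Suc k dvd (fps_X ^ (2 * k) :: 'a fps)"
      using k by (intro le_imp_power_dvd) auto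
    ultimately have "fps_X ^ Suc k dvd (f - g) oo W" by (rule dvd_trans[rotated])
    then have 2: "fps_X ^ Suc k dvd c * w * ((f - g) oo W)" by (rule dvd_mult)
    have "T f - T g = (f - g) - c * (f ^ N - g ^ N) + c * w * ((f - g) oo W)"
      by (simp add: T_def fps_compose_sub_distrib algebra_simps)
    also have "\<dots> = (f - g) * (1 - c * S) + c * w * ((f - g) oo W)"
      by (simp add: power_diff_sumr2[of f N g] S_def algebra_simps)
    finally show "fps_X ^ Suc k dvd T f - T g" using 1 2 by simp
  qed
  have "c * (\<beta> ^ N - w * (\<beta> oo W)) = 0" using \<beta>(2) by (simp add: T_def)
  moreover have "c \<noteq> 0" using assms(1) by (simp add: c_def)
  ultimately show thesis using \<beta>(1) that by simp
qed

definition fps_conjugate :: "'a::field fps \<Rightarrow> 'a fps \<Rightarrow> 'a fps" where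
  "fps_conjugate L A = fps_inv L oo A oo L"

lemma subdegree_1_nth:
  assumes "subdegree L = 1"
  shows "L $ 0 = 0" "L $ 1 \<noteq> 0"
proof -
  have "0 < subdegree L" by (simp add: assms)
  then show "L $ 0 = 0" by (rule nth_less_subdegree_zero)
  have "L \<noteq> 0" using assms by (metis subdegree_0 zero_neq_one)
  then have "L $ subdegree L \<noteq> 0" by (rule nth_subdegree_nonzero)
  then show "L $ 1 \<noteq> 0" unfolding assms .
qed

lemma fps_inv_nth_0 [simp]: "fps_inv L $ 0 = 0"
  by (simp add: fps_inv_def)

lemma subdegree_fps_inv:
  assumes "subdegree L = 1"
  shows "subdegree (fps_inv L) = 1"
proof -
  have "subdegree (fps_inv L oo L) = 1"
    using fps_inv[OF subdegree_1_nth[OF assms]] by simp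
  then show ?thesis using subdegree_1_nth[OF assms] assms by simp
qed

text \<open>
  It is easier to find the inverse \<open>B\<close> of the coordinate change: it has to satisfy
  \<open>B \<circ> W = B\<^sup>N\<close>. Writing \<open>B = l X \<beta>\<close> and \<open>W = c X\<^sup>N w\<close> separates the leading coefficient, which
  requires \<open>l\<^sup>N = c l\<close>, from the equation \<open>\<beta>\<^sup>N = w (\<beta> \<circ> W)\<close> between series with constant term \<open>1\<close>.
\<close>

lemma bottcher:
  fixes W :: "'k::alg_closed_field fps"
  assumes "subdegree W = N" "N > 1" "of_nat N \<noteq> (0::'k)"
  obtains L where "subdegree L = 1" "fps_conjugate L W = fps_X ^ N"
proof -
  have "W \<noteq> 0" using assms by auto
  then obtain c w where c: "c \<noteq> 0" and W: "W = fps_const c * fps_X ^ N * w" and w0: "w $ 0 = 1"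
    using fps_monomial_times_unit[of W] assms(1) by metis
  have W2: "fps_X ^ 2 dvd W" using assms
    by (auto simp: fps_X_power_dvd_iff intro!: nth_less_subdegree_zero)
  have W0: "W $ 0 = 0" using assms by (auto intro: nth_less_subdegree_zero)
  obtain \<beta> where \<beta>: "\<beta> $ 0 = 1" "\<beta> ^ N = w * (\<beta> oo W)"
    using bottcher_unit_equation[OF assms(3) w0 W2] .
  obtain l where l: "l ^ (N - 1) = c" using nth_root_exists[of "N - 1" c] assms(2) by auto
  have l0: "l \<noteq> 0" using l c assms(2) by (auto simp: power_0_left)
  have lN: "l ^ N = c * l" using l assms(2) by (metis Suc_diff_1 less_trans mult.commute power_Suc zero_less_one)
  define B where "B = fps_const l * fps_X * \<beta>"
  have "B oo W = fps_const l * W * (\<beta> oo W)"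
    using W0 by (simp add: B_def fps_compose_mult_distrib)
  also have "\<dots> = fps_const (c * l) * fps_X ^ N * (w * (\<beta> oo W))"
    by (subst W) (simp only: mult_ac fps_const_mult[symmetric])
  also have "\<dots> = B ^ N"
    by (simp add: B_def power_mult_distrib \<beta>(2)[symmetric] lN[symmetric])
  finally have BW: "B oo W = B ^ N" .
  have B: "subdegree B = 1" using l0 \<beta>(1)
    by (intro subdegreeI) (auto simp: B_def mult.assoc)
  note B01 = subdegree_1_nth[OF B]
  define L where "L = fps_inv B"
  have L: "subdegree L = 1" using subdegree_fps_inv[OF B] by (simp add: L_def)
  have BL: "B oo L = fps_X" using fps_inv_right[OF B01] by (simp add: L_def)
  have "fps_inv L = B oo L oo fps_inv L" using BL by simp
  also have "\<dots> = B oo (L oo fps_inv L)"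
    by (rule fps_compose_assoc[symmetric]) (auto simp: L_def)
  also have "\<dots> = B" using fps_inv_right[OF subdegree_1_nth[OF L]] by simp
  finally have "fps_conjugate L W = B ^ N oo L" by (simp add: fps_conjugate_def BW)
  also have "\<dots> = fps_X ^ N" using BL by (simp add: L_def flip: fps_compose_power)
  finally show thesis using L that by blast
qed

section \<open>Conjugation of words\<close>

lemma fps_conjugate_compose:
  assumes L: "subdegree L = 1" and "A $ 0 = 0" "B $ 0 = 0"
  shows "fps_conjugate L (A oo B) = fps_conjugate L A oo fps_conjugate L B"
proof -
  note L01 = subdegree_1_nth[OF L]
  have "fps_conjugate L A oo fps_conjugate L B = fps_inv L oo A oo (L oo (fps_inv L oo (B oo L)))"
    using assms L01 by (simp add: fps_conjugate_def fps_compose_assoc)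
  also have "L oo (fps_inv L oo (B oo L)) = B oo L"
    using assms L01 fps_inv_right[OF L01] by (simp add: fps_compose_assoc)
  finally show ?thesis using assms L01 by (simp add: fps_conjugate_def fps_compose_assoc)
qed

lemma fps_conjugate_X:
  assumes "subdegree L = 1"
  shows "fps_conjugate L fps_X = fps_X"
  using fps_inv[OF subdegree_1_nth[OF assms]] by (simp add: fps_conjugate_def)

lemma subdegree_fps_conjugate:
  assumes "subdegree L = 1" "A $ 0 = 0"
  shows "subdegree (fps_conjugate L A) = subdegree A"
  using assms subdegree_1_nth[OF assms(1)] subdegree_fps_inv[OF assms(1)]
  by (simp add: fps_conjugate_def)

lemma fps_conjugate_inj:
  assumes L: "subdegree L = 1" and "A $ 0 = 0" "B $ 0 = 0"
    and eq: "fps_conjugate L A = fps_conjugate L B"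
  shows "A = B"
proof -
  note L01 = subdegree_1_nth[OF L]
  have *: "L oo fps_conjugate L C = C oo L" if "C $ 0 = 0" for C
    using that L01 fps_inv_right[OF L01] by (simp add: fps_conjugate_def fps_compose_assoc)
  have "A oo L = B oo L" using *[of A] *[of B] eq assms by simp
  then show ?thesis using fps_compose_inj_right[OF L01] by blast
qed

lemma fps_inv_compose:
  assumes L: "subdegree L = 1" and M: "subdegree M = 1"
  shows "fps_inv (L oo M) = fps_inv M oo fps_inv L"
proof -
  note L01 = subdegree_1_nth[OF L] and M01 = subdegree_1_nth[OF M]
  have LM: "subdegree (L oo M) = 1" using L M M01 by simp
  note LM01 = subdegree_1_nth[OF LM]
  have "fps_inv M oo fps_inv L oo (L oo M) = fps_inv M oo (fps_inv L oo L oo M)"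
    using L01 M01 by (simp add: fps_compose_assoc)
  also have "\<dots> = fps_X" using L01 M01 by (simp add: fps_inv)
  also have "\<dots> = fps_inv (L oo M) oo (L oo M)" using fps_inv[OF LM01] by simp
  finally show ?thesis using fps_compose_inj_right[OF LM01] by metis
qed

lemma fps_conjugate_conjugate:
  assumes "subdegree L = 1" "subdegree M = 1" "A $ 0 = 0"
  shows "fps_conjugate M (fps_conjugate L A) = fps_conjugate (L oo M) A"
  using subdegree_1_nth[OF assms(1)] subdegree_1_nth[OF assms(2)] assms(3)
  by (simp add: fps_conjugate_def fps_inv_compose[OF assms(1,2)] fps_compose_assoc)

lemma letter_series_nth_0:
  assumes "F $ 0 = 0" "G $ 0 = 0"
  shows "letter_series F G a $ 0 = 0"
  using assms by (cases a) auto

lemma comp_word_conjugate: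
  assumes L: "subdegree L = 1" and FG: "F $ 0 = 0" "G $ 0 = 0"
  shows "comp_word (fps_conjugate L F) (fps_conjugate L G) w = fps_conjugate L (comp_word F G w)"
proof (induction w)
  case Nil
  then show ?case using fps_conjugate_X[OF L] by simp
next
  case (Cons a w)
  have "letter_series (fps_conjugate L F) (fps_conjugate L G) a = fps_conjugate L (letter_series F G a)"
    by (cases a) auto
  then show ?case
    using Cons fps_conjugate_compose[OF L] letter_series_nth_0[OF FG] comp_word_nth_0[OF FG] by simp
qed

lemma compose_of_monomial_forms:
  fixes A B :: "'a::field fps"
  assumes "A = fps_const a * fps_X ^ d * \<phi>" "B = fps_const b * fps_X ^ e * \<psi>" "B $ 0 = 0"
  shows "A oo B = fps_const (a * b ^ d) * fps_X ^ (e * d) * (\<psi> ^ d * (\<phi> oo B))"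
proof -
  have "A oo B = fps_const a * B ^ d * (\<phi> oo B)"
    using assms(1,3) by (simp add: fps_compose_mult_distrib flip: fps_compose_power)
  also have "B ^ d = fps_const (b ^ d) * fps_X ^ (e * d) * \<psi> ^ d"
    by (subst assms(2)) (simp add: power_mult_distrib power_mult)
  finally show ?thesis by (simp only: mult.assoc fps_const_mult[symmetric])
qed

lemma fps_compose_monomials:
  fixes a b :: "'a::field"
  assumes "e > 0"
  shows "(fps_const a * fps_X ^ d) oo (fps_const b * fps_X ^ e) = fps_const (a * b ^ d) * fps_X ^ (e * d)"
  using compose_of_monomial_forms[of "fps_const a * fps_X ^ d" a d 1 "fps_const b * fps_X ^ e" b e 1] assms
  by simp

lemma fps_conjugate_scaling_monomial:
  fixes c l :: "'a::field"
  assumes "l \<noteq> 0" "d > 0"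
  shows "fps_conjugate (fps_const l * fps_X) (fps_const c * fps_X ^ d) =
    fps_const (c * l ^ (d - 1)) * fps_X ^ d"
proof -
  let ?M = "fps_const l * fps_X :: 'a fps" and ?M' = "fps_const (1 / l) * fps_X :: 'a fps"
  have M: "subdegree ?M = 1" using assms by (intro subdegreeI) auto
  note M01 = subdegree_1_nth[OF M]
  have "?M' oo ?M = fps_X" using assms by (simp add: fps_compose_mult_distrib flip: mult.assoc)
  also have "\<dots> = fps_inv ?M oo ?M" using fps_inv[OF M01] by simp
  finally have inv: "fps_inv ?M = ?M'" using fps_compose_inj_right[OF M01] by metis
  have "fps_conjugate ?M (fps_const c * fps_X ^ d) = ?M' oo (fps_const (c * l ^ d) * fps_X ^ d)"
    using M01 assms fps_compose_monomials[of 1 c d l]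
    by (simp add: fps_conjugate_def inv flip: fps_compose_assoc)
  also have "\<dots> = fps_const (1 / l * (c * l ^ d)) * fps_X ^ d"
    using fps_compose_monomials[of d "1 / l" 1 "c * l ^ d"] assms by simp
  also have "1 / l * (c * l ^ d) = c * l ^ (d - 1)"
    using assms by (cases d) simp_all
  finally show ?thesis .
qed

section \<open>Degrees of words and cancellation\<close>

fun word_degree :: "nat \<Rightarrow> nat \<Rightarrow> letter list \<Rightarrow> nat" where
  "word_degree m n [] = 1"
| "word_degree m n (LF # w) = m * word_degree m n w"
| "word_degree m n (LG # w) = n * word_degree m n w"

lemma word_degree_append: "word_degree m n (v @ w) = word_degree m n v * word_degree m n w"
  by (induction m n v rule: word_degree.induct) simp_all

lemma word_degree_pos: "m > 0 \<Longrightarrow> n > 0 \<Longrightarrow> word_degree m n w > 0"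
  by (induction m n w rule: word_degree.induct) simp_all

lemma word_degree_gt_1:
  assumes "m > 1" "n > 1" "w \<noteq> []"
  shows "word_degree m n w > 1"
proof (cases w)
  case (Cons a v)
  have "word_degree m n v > 0" using assms by (intro word_degree_pos) auto
  then show ?thesis using assms Cons
    by (cases a) (auto intro: less_le_trans[OF _ mult_le_mono2[of 1]])
qed (use assms in simp)

lemma subdegree_comp_word:
  assumes "F $ 0 = 0" "G $ 0 = 0"
  shows "subdegree (comp_word F G w) = word_degree (subdegree F) (subdegree G) w"
proof (induction w)
  case (Cons a w)
  then show ?case using comp_word_nth_0[OF assms] by (cases a) simp_all
qed simp

lemma of_nat_word_degree_nonzero:
  assumes "of_nat m \<noteq> (0::'a::idom)" "of_nat n \<noteq> (0::'a)"
  shows "of_nat (word_degree m n w) \<noteq> (0::'a)"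
  using assms by (induction m n w rule: word_degree.induct) simp_all

text \<open>
  Composition with a nonconstant series is injective in the left argument, so equal last letters
  can be cancelled. Neither word can be used up before the other, since a nonempty word has
  degree greater than \<open>1\<close> and therefore is not the identity.
\<close>

lemma equal_words_distinct_last_letters:
  fixes F G :: "'a::field fps"
  assumes FG: "subdegree F > 1" "subdegree G > 1"
    and eq: "comp_word F G v = comp_word F G w" "v \<noteq> w"
  obtains v' w' where "comp_word F G (v' @ [LF]) = comp_word F G (w' @ [LG])"
proof -
  have F0: "F $ 0 = 0" and G0: "G $ 0 = 0" using FG by (auto intro: nth_less_subdegree_zero)
  have nonempty: "comp_word F G x \<noteq> fps_X" if "x \<noteq> []" for x
    using subdegree_comp_word[OF F0 G0, of x] word_degree_gt_1[OF FG that] by auto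
  have "\<exists>v' w'. comp_word F G (v' @ [LF]) = comp_word F G (w' @ [LG])"
    using eq
  proof (induction v arbitrary: w rule: rev_induct)
    case Nil
    then show ?case using nonempty[of w] by auto
  next
    case (snoc a v)
    have "w \<noteq> []" using snoc.prems nonempty[of "v @ [a]"] by auto
    then obtain w' b where w: "w = w' @ [b]" by (metis rev_exhaust)
    show ?case
    proof (cases "a = b")
      case True
      have "comp_word F G [a] $ 0 = 0" "comp_word F G [a] \<noteq> 0"
        using FG F0 G0 by (cases a; auto)+
      moreover have "(comp_word F G v - comp_word F G w') oo comp_word F G [a] = 0"
        using snoc.prems True unfolding w
        by (simp add: comp_word_append[OF F0 G0] fps_compose_sub_distrib)
      ultimately have "comp_word F G v = comp_word F G w'"
        by (simp add: fps_compose_eq_0_iff)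
      then show ?thesis using snoc True w by auto
    next
      case False
      then have "a = LF \<and> b = LG \<or> a = LG \<and> b = LF" by (cases a; cases b) auto
      then show ?thesis using snoc.prems(1) w by metis
    qed
  qed
  then show thesis using that by blast
qed

section \<open>A relation forces monomials\<close>

text \<open>
  For \<open>r > 0\<close> and in the language of gaps: the gap of \<open>A\<close> is at least \<open>r\<close>. The factor \<open>\<phi>\<close> is kept explicit because
  its behaviour under powers and composition is what the gap estimates use.
\<close>

definition monomial_mod :: "nat \<Rightarrow> 'a::field fps \<Rightarrow> bool" where
  "monomial_mod r A \<longleftrightarrow>
    (\<exists>c \<phi>. c \<noteq> 0 \<and> A = fps_const c * fps_X ^ subdegree A * \<phi> \<and> fps_X ^ r dvd \<phi> - 1)"

lemma monomial_modE:
  assumes "monomial_mod r A"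
  obtains c \<phi> where "c \<noteq> 0" "A = fps_const c * fps_X ^ subdegree A * \<phi>" "fps_X ^ r dvd \<phi> - 1"
  using assms unfolding monomial_mod_def by blast

lemma nth_0_eq_1:
  fixes \<phi> :: "'a::field fps"
  assumes "fps_X ^ r dvd \<phi> - 1" "r > 0"
  shows "\<phi> $ 0 = 1"
  using assms by (simp add: fps_X_power_dvd_iff)

lemma monomial_modI:
  assumes "c \<noteq> 0" "A = fps_const c * fps_X ^ d * \<phi>" "fps_X ^ r dvd \<phi> - 1" "r > 0"
  shows "monomial_mod r A"
proof -
  have "subdegree A = d"
    using assms(1,2) nth_0_eq_1[OF assms(3,4)]
    by (intro subdegreeI) (auto simp: mult.assoc fps_X_power_mult_nth)
  then show ?thesis using assms unfolding monomial_mod_def by blast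
qed

text \<open>
  The start of the induction: every gap is at least \<open>1\<close>.
\<close>

lemma monomial_mod_1:
  fixes A :: "'a::field fps"
  assumes "A \<noteq> 0"
  shows "monomial_mod 1 A"
proof -
  obtain c \<phi> where "c \<noteq> 0" "A = fps_const c * fps_X ^ subdegree A * \<phi>" "\<phi> $ 0 = 1"
    using fps_monomial_times_unit[OF assms] .
  then show ?thesis by (intro monomial_modI) (auto simp: fps_X_power_dvd_iff[of 1, simplified])
qed

lemma dvd_mult_minus_1:
  fixes x a b :: "'a::comm_ring_1"
  assumes "x dvd a - 1" "x dvd b - 1"
  shows "x dvd a * b - 1"
proof -
  have eq: "a * b - 1 = (a - 1) * b + (b - 1)" by (simp add: algebra_simps)
  show ?thesis unfolding eq using assms by (intro dvd_add dvd_mult2)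
qed

lemma dvd_power_minus_1:
  fixes x a :: "'a::comm_ring_1"
  assumes "x dvd a - 1"
  shows "x dvd a ^ k - 1"
  using assms by (simp add: power_diff_1_eq)

text \<open>
  Composition on the right with \<open>B\<close> multiplies a gap by the degree of \<open>B\<close>. This factor is the source
  of the improvement from \<open>r\<close> to \<open>Suc r\<close> below.
\<close>

lemma dvd_compose_minus_1:
  fixes \<phi> B :: "'a::field fps"
  assumes "fps_X ^ r dvd \<phi> - 1" "subdegree B > 0"
  shows "fps_X ^ (subdegree B * r) dvd (\<phi> oo B) - 1"
proof -
  have "fps_X ^ subdegree B dvd B"
    by (auto simp: fps_X_power_dvd_iff intro: nth_less_subdegree_zero)
  from power_fps_X_dvd_compose[OF this assms(2,1)] show ?thesis
    by (simp add: fps_compose_sub_distrib)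
qed

lemma monomial_mod_compose:
  assumes A: "monomial_mod r A" and B: "monomial_mod r B" and r: "r > 0" and "subdegree B > 0"
  shows "monomial_mod r (A oo B)"
proof -
  obtain a \<phi> where a: "a \<noteq> 0" "A = fps_const a * fps_X ^ subdegree A * \<phi>" "fps_X ^ r dvd \<phi> - 1"
    using monomial_modE[OF A] .
  obtain b \<psi> where b: "b \<noteq> 0" "B = fps_const b * fps_X ^ subdegree B * \<psi>" "fps_X ^ r dvd \<psi> - 1"
    using monomial_modE[OF B] .
  have B0: "B $ 0 = 0" using assms(4) by (auto intro: nth_less_subdegree_zero)
  show ?thesis
  proof (rule monomial_modI[OF _ compose_of_monomial_forms[OF a(2) b(2) B0] _ r])
    show "a * b ^ subdegree A \<noteq> 0" using a(1) b(1) by simp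
    have "fps_X ^ r dvd (fps_X ^ (subdegree B * r) :: 'a fps)"
      using assms(4) by (intro le_imp_power_dvd) auto
    then have "fps_X ^ r dvd (\<phi> oo B) - 1"
      using dvd_compose_minus_1[OF a(3) assms(4)] by (rule dvd_trans)
    then show "fps_X ^ r dvd \<psi> ^ subdegree A * (\<phi> oo B) - 1"
      using b(3) by (intro dvd_mult_minus_1 dvd_power_minus_1)
  qed
qed

lemma monomial_mod_comp_word:
  assumes "monomial_mod r F" "monomial_mod r G" "r > 0" "subdegree F > 0" "subdegree G > 0"
  shows "monomial_mod r (comp_word F G w)"
proof (induction w)
  case Nil
  show ?case by (rule monomial_modI[of 1 _ 1 1]) (use assms in auto)
next
  case (Cons a w)
  have "F $ 0 = 0" "G $ 0 = 0" using assms by (auto intro: nth_less_subdegree_zero)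
  then have "subdegree (comp_word F G w) > 0"
    using word_degree_pos[OF assms(4,5)] by (simp add: subdegree_comp_word)
  then show ?case using Cons assms by (cases a) (auto intro!: monomial_mod_compose)
qed

text \<open>
  The cofactor of \<open>\<psi> - 1\<close> in \<open>\<psi>\<^sup>d - 1\<close> has constant term \<open>d\<close>. This is where it matters that the
  characteristic does not divide the degrees: \<open>(1 + X)\<^sup>p = 1 + X\<^sup>p\<close> in characteristic \<open>p\<close>.
\<close>

lemma dvd_minus_1_of_power:
  fixes \<psi> :: "'a::field fps"
  assumes "fps_X ^ s dvd \<psi> ^ d - 1" "\<psi> $ 0 = 1" "of_nat d \<noteq> (0::'a)"
  shows "fps_X ^ s dvd \<psi> - 1"
proof -
  define S where "S = (\<Sum>i<d. \<psi> ^ i)"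
  have "S $ 0 = of_nat d" using assms(2) by (simp add: S_def fps_sum_nth fps_nth_power_0)
  then have "S dvd 1" using assms(3) by simp
  moreover have "fps_X ^ s dvd (\<psi> - 1) * S" using assms(1) by (simp add: power_diff_1_eq S_def)
  ultimately show ?thesis by (simp add: dvd_mult_unit_iff)
qed

text \<open>
  Write \<open>u = a X\<^sup>d \<phi>\<close> and \<open>F = b X\<^sup>m \<psi>\<close>. Comparing \<open>u \<circ> F\<close> with \<open>X\<^sup>N\<close> gives \<open>\<psi>\<^sup>d (\<phi> \<circ> F) = 1\<close>. Since
  \<open>\<phi>\<close> is \<open>1\<close> modulo \<open>X\<^sup>r\<close>, the factor \<open>\<phi> \<circ> F\<close> is \<open>1\<close> even modulo \<open>X\<close> to the power \<open>m r\<close>, and the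
  same follows for \<open>\<psi>\<^sup>d\<close> and then for \<open>\<psi>\<close>. Finally \<open>m r > r\<close>.
\<close>

lemma monomial_mod_improve:
  fixes u F :: "'a::field fps"
  assumes u: "monomial_mod r u" and F: "monomial_mod r F" and r: "r > 0"
    and m: "subdegree F > 1" and d: "of_nat (subdegree u) \<noteq> (0::'a)"
    and eq: "u oo F = fps_X ^ N"
  shows "monomial_mod (Suc r) F"
proof -
  define d where "d = subdegree u"
  obtain a \<phi> where a: "a \<noteq> 0" "u = fps_const a * fps_X ^ d * \<phi>" "fps_X ^ r dvd \<phi> - 1"
    using monomial_modE[OF u] d_def by blast
  obtain b \<psi> where b: "b \<noteq> 0" "F = fps_const b * fps_X ^ subdegree F * \<psi>" "fps_X ^ r dvd \<psi> - 1"
    using monomial_modE[OF F] .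
  have F0: "F $ 0 = 0" using m by (auto intro: nth_less_subdegree_zero)
  have \<psi>0: "\<psi> $ 0 = 1" and \<phi>0: "\<phi> $ 0 = 1" using nth_0_eq_1[OF _ r] a(3) b(3) by auto
  have "subdegree (u oo F) = N" using eq by simp
  then have N: "N = subdegree F * d" using F0 by (simp add: d_def mult.commute)
  define \<chi> where "\<chi> = \<phi> oo F"
  have "fps_X ^ N = fps_const (a * b ^ d) * fps_X ^ N * (\<psi> ^ d * \<chi>)"
    using compose_of_monomial_forms[OF a(2) b(2) F0] unfolding eq N \<chi>_def .
  then have "fps_X ^ N * (fps_const (a * b ^ d) * (\<psi> ^ d * \<chi>)) = fps_X ^ N * 1"
    by (simp only: mult_ac mult_1_left mult_1_right)
  then have one: "fps_const (a * b ^ d) * (\<psi> ^ d * \<chi>) = 1"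
    by (subst (asm) mult_left_cancel) auto
  then have "(fps_const (a * b ^ d) * (\<psi> ^ d * \<chi>)) $ 0 = 1" by simp
  then have "a * b ^ d = 1" using \<psi>0 \<phi>0 by (simp add: \<chi>_def fps_nth_power_0)
  with one have one': "\<psi> ^ d * \<chi> = 1" by simp
  have "fps_X ^ (subdegree F * r) dvd \<chi> - 1"
    unfolding \<chi>_def using m by (intro dvd_compose_minus_1[OF a(3)]) simp
  then have "fps_X ^ (subdegree F * r) dvd - (\<psi> ^ d * (\<chi> - 1))" by (simp add: dvd_mult)
  also have "- (\<psi> ^ d * (\<chi> - 1)) = \<psi> ^ d - 1" using one' by (simp add: algebra_simps)
  finally have "fps_X ^ (subdegree F * r) dvd \<psi> ^ d - 1" .
  then have *: "fps_X ^ (subdegree F * r) dvd \<psi> - 1"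
    using \<psi>0 assms(5) unfolding d_def by (rule dvd_minus_1_of_power)
  have "Suc r \<le> 2 * r" using r by simp
  also have "\<dots> \<le> subdegree F * r" using m by (intro mult_right_mono) auto
  finally have "(fps_X :: 'a fps) ^ Suc r dvd fps_X ^ (subdegree F * r)" by (rule le_imp_power_dvd)
  then have "fps_X ^ Suc r dvd \<psi> - 1" using * by (rule dvd_trans)
  then show ?thesis using monomial_modI[OF b(1,2)] by blast
qed

lemma monomial_if_monomial_mod_all:
  fixes A :: "'a::field fps"
  assumes "\<And>r. r > 0 \<Longrightarrow> monomial_mod r A"
  obtains c where "c \<noteq> 0" "A = fps_const c * fps_X ^ subdegree A"
proof -
  define d where "d = subdegree A"
  have "A $ i = 0" if "i \<noteq> d" for i
  proof (cases "i < d")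
    case True
    then show ?thesis by (auto simp: d_def intro: nth_less_subdegree_zero)
  next
    case False
    obtain c \<phi> where c: "A = fps_const c * fps_X ^ d * \<phi>" "fps_X ^ Suc i dvd \<phi> - 1"
      using monomial_modE[OF assms[of "Suc i"]] d_def by blast
    have "(\<phi> - 1) $ (i - d) = 0" using c(2) unfolding fps_X_power_dvd_iff by simp
    then have "\<phi> $ (i - d) = 0" using that False by simp
    then show ?thesis using False by (subst c(1)) (simp add: mult.assoc fps_X_power_mult_nth)
  qed
  then have "A = fps_const (A $ d) * fps_X ^ d" by (intro fps_ext) auto
  moreover have "A \<noteq> 0" using monomial_modE[OF assms[of 1]] nth_0_eq_1
    by (metis fps_const_eq_0_iff fps_X_neq_zero fps_zero_nth mult_eq_0_iff power_eq_0_iff zero_less_one zero_neq_one)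
  then have "A $ d \<noteq> 0" by (simp add: d_def)
  ultimately show thesis using that d_def by blast
qed

text \<open>
  The induction must treat \<open>F\<close> and \<open>G\<close> simultaneously: a bound for both gaps gives the bound for the
  words \<open>u\<close> and \<open>v\<close>, and these in turn improve the bounds for \<open>F\<close> and for \<open>G\<close>.
\<close>

lemma letters_are_monomials:
  fixes F G :: "'a::field fps"
  assumes FG: "subdegree F > 1" "subdegree G > 1"
    and char: "of_nat (subdegree F) \<noteq> (0::'a)" "of_nat (subdegree G) \<noteq> (0::'a)"
    and u: "comp_word F G (u @ [LF]) = fps_X ^ N"
    and v: "comp_word F G (v @ [LG]) = fps_X ^ N"
  obtains a b where "a \<noteq> 0" "F = fps_const a * fps_X ^ subdegree F"
    "b \<noteq> 0" "G = fps_const b * fps_X ^ subdegree G"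
proof -
  have F0: "F $ 0 = 0" and G0: "G $ 0 = 0" using FG by (auto intro: nth_less_subdegree_zero)
  have u': "comp_word F G u oo F = fps_X ^ N" and v': "comp_word F G v oo G = fps_X ^ N"
    using u v by (simp_all add: comp_word_append[OF F0 G0])
  have char': "of_nat (subdegree (comp_word F G w)) \<noteq> (0::'a)" for w
    using of_nat_word_degree_nonzero[OF char] by (simp add: subdegree_comp_word[OF F0 G0])
  have "monomial_mod r F \<and> monomial_mod r G" if "r > 0" for r
    using that
  proof (induction r rule: nat_induct_non_zero)
    case 1
    have "F \<noteq> 0" "G \<noteq> 0" using FG by auto
    then show ?case by (intro conjI monomial_mod_1)
  next
    case (Suc r)
    then have "monomial_mod r (comp_word F G w)" for w
      using FG by (intro monomial_mod_comp_word) auto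
    then show ?case using Suc FG char' u' v' by (blast intro: monomial_mod_improve)
  qed
  then show thesis using monomial_if_monomial_mod_all[of F] monomial_if_monomial_mod_all[of G] that
    by metis
qed

section \<open>Words in two monomials\<close>

text \<open>
  The exponent of \<open>\<alpha>\<close> in a word in \<open>X\<^sup>m\<close> and \<open>\<alpha> X\<^sup>n\<close>, see \<open>comp_word_monomials\<close> below. Together with
  the degree it describes a composition of the affine maps \<open>x \<mapsto> m x\<close> and \<open>x \<mapsto> n x + 1\<close>, namely
  \<open>x \<mapsto> word_degree * x + word_exponent\<close>.
\<close>

fun word_exponent :: "nat \<Rightarrow> nat \<Rightarrow> letter list \<Rightarrow> nat" where
  "word_exponent m n [] = 0"
| "word_exponent m n (LF # w) = m * word_exponent m n w"
| "word_exponent m n (LG # w) = 1 + n * word_exponent m n w"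

lemma word_exponent_append:
  "word_exponent m n (v @ w) = word_exponent m n v + word_degree m n v * word_exponent m n w"
  by (induction m n v rule: word_exponent.induct) (simp_all add: algebra_simps)

lemma comp_word_monomials:
  fixes \<alpha> :: "'a::field"
  assumes "m > 0" "n > 0"
  shows "comp_word (fps_X ^ m) (fps_const \<alpha> * fps_X ^ n) w =
    fps_const (\<alpha> ^ word_exponent m n w) * fps_X ^ word_degree m n w"
  using assms
proof (induction m n w rule: word_degree.induct)
  case (1 m n)
  then show ?case by simp
next
  case (2 m n w)
  then show ?case
    using fps_compose_monomials[OF word_degree_pos[OF 2(2,3), of w], of 1 m "\<alpha> ^ word_exponent m n w"]
    by (simp add: mult.commute flip: power_mult)
next
  case (3 m n w)
  then show ?case
    using fps_compose_monomials[OF word_degree_pos[OF 3(2,3), of w], of \<alpha> n "\<alpha> ^ word_exponent m n w"]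
    by (simp add: mult.commute flip: power_mult)
qed

text \<open>
  For \<open>n > 1\<close>, the affine map of a word sends \<open>-1/(n-1)\<close>, the fixed point of \<open>x \<mapsto> n x + 1\<close>, to a negative number,
  since both generators preserve the numbers that are at most \<open>-1/(n-1)\<close>.
\<close>

lemma word_exponent_less:
  assumes "m > 0" "n > 0"
  shows "(n - 1) * word_exponent m n w < word_degree m n w"
  using assms
proof (induction m n w rule: word_degree.induct)
  case (2 m n w)
  then have "m * ((n - 1) * word_exponent m n w) < m * word_degree m n w" by simp
  then show ?case by (simp add: mult_ac)
next
  case (3 m n w)
  then have "Suc ((n - 1) * word_exponent m n w) \<le> word_degree m n w" by simp
  then have "n * Suc ((n - 1) * word_exponent m n w) \<le> n * word_degree m n w"
    by (rule mult_le_mono2)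
  moreover have "(n - 1) * (1 + n * word_exponent m n w) < n * Suc ((n - 1) * word_exponent m n w)"
    using 3 by (cases n) (simp_all add: algebra_simps)
  ultimately show ?case unfolding word_exponent.simps word_degree.simps by linarith
qed simp

text \<open>
  Equality would mean that the two words give the same affine map. The inverses of \<open>x \<mapsto> m x\<close> and
  \<open>x \<mapsto> n x + 1\<close> map the interval from \<open>-1/(n-1)\<close> to \<open>0\<close> into subintervals of itself that have at most
  one point in common, because \<open>1/m + 1/n \<le> 1\<close>; so the affine maps of words with different last
  letters, the letters applied first, are different. The computation below is this argument in
  terms of natural numbers.
\<close>

lemma word_exponent_neq:
  assumes m: "m > 1" and n: "n > 1"
    and deg: "word_degree m n (u @ [LF]) = word_degree m n (v @ [LG])"
  shows "word_exponent m n (u @ [LF]) \<noteq> word_exponent m n (v @ [LG])"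
proof
  let ?D = "word_degree m n v"
  assume "word_exponent m n (u @ [LF]) = word_exponent m n (v @ [LG])"
  then have "?D \<le> word_exponent m n u" by (simp add: word_exponent_append)
  then have "(n - 1) * ?D \<le> (n - 1) * word_exponent m n u" by simp
  also have "\<dots> < word_degree m n u" using m n by (intro word_exponent_less) auto
  finally have "m * ((n - 1) * ?D) < m * word_degree m n u" using m by simp
  also have "m * word_degree m n u = n * ?D" using deg by (simp add: word_degree_append mult.commute)
  finally have "(m * (n - 1)) * ?D < n * ?D" by (simp add: mult.assoc)
  then have "m * (n - 1) < n" by simp
  moreover have "2 * (n - 1) \<le> m * (n - 1)" using m by (intro mult_le_mono1) auto
  ultimately show False using n by linarith
qed

lemma root_of_unity_if_powers_eq:
  fixes \<alpha> :: "'a::field"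
  assumes "\<alpha> \<noteq> 0" "\<alpha> ^ i = \<alpha> ^ j" "i \<noteq> j"
  shows "\<exists>k>0. \<alpha> ^ k = 1"
  using assms(2,3)
proof (induction i j rule: linorder_wlog)
  case (le i j)
  have "\<alpha> ^ i * \<alpha> ^ (j - i) = \<alpha> ^ j" using le(1) by (simp flip: power_add)
  also have "\<dots> = \<alpha> ^ i * 1" using le(2) by simp
  finally have "\<alpha> ^ i * \<alpha> ^ (j - i) = \<alpha> ^ i * 1" .
  then have "\<alpha> ^ (j - i) = 1" using assms(1) by (subst (asm) mult_left_cancel) auto
  then show ?case using le by (intro exI[of _ "j - i"]) auto
qed metis

section \<open>The equivalence\<close>

lemma not_free_imp_conjugate_monomials:
  fixes F G :: "'k::alg_closed_field fps"
  assumes F: "subdegree F = m" and G: "subdegree G = n" and m: "m > 1" and n: "n > 1"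
    and char: "\<not> CHAR('k) dvd m * n"
    and eq: "comp_word F G v = comp_word F G w" "v \<noteq> w"
  obtains L \<alpha> where "subdegree L = 1" "fps_conjugate L F = fps_X ^ m"
    "\<alpha> \<noteq> 0" "\<exists>k>0. \<alpha> ^ k = 1" "fps_conjugate L G = fps_const \<alpha> * fps_X ^ n"
proof -
  have "of_nat (m * n) \<noteq> (0::'k)" using char by (simp only: of_nat_eq_0_iff_char_dvd not_False_eq_True)
  then have char_m: "of_nat m \<noteq> (0::'k)" and char_n: "of_nat n \<noteq> (0::'k)" by auto
  have F0: "F $ 0 = 0" and G0: "G $ 0 = 0" using F G m n by (auto intro: nth_less_subdegree_zero)
  obtain x y where xy: "comp_word F G (x @ [LF]) = comp_word F G (y @ [LG])"
    using equal_words_distinct_last_letters[OF _ _ eq] F G m n by auto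
  define W where "W = comp_word F G (x @ [LF])"
  define N where "N = word_degree m n (x @ [LF])"
  have W: "subdegree W = N" unfolding W_def N_def subdegree_comp_word[OF F0 G0] F G ..
  have "N > 1" unfolding N_def using m n by (intro word_degree_gt_1) auto
  moreover have "of_nat N \<noteq> (0::'k)"
    unfolding N_def using char_m char_n by (rule of_nat_word_degree_nonzero)
  ultimately obtain L where L: "subdegree L = 1" "fps_conjugate L W = fps_X ^ N"
    using bottcher[OF W] by blast
  define F1 where "F1 = fps_conjugate L F"
  define G1 where "G1 = fps_conjugate L G"
  have deg1: "subdegree F1 = m" "subdegree G1 = n"
    using subdegree_fps_conjugate[OF L(1)] F0 G0 F G by (simp_all add: F1_def G1_def)
  have "comp_word F1 G1 (x @ [LF]) = fps_X ^ N" "comp_word F1 G1 (y @ [LG]) = fps_X ^ N"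
    using L(2) xy unfolding F1_def G1_def comp_word_conjugate[OF L(1) F0 G0] W_def by simp_all
  then obtain a b where a: "a \<noteq> 0" "F1 = fps_const a * fps_X ^ m"
    and b: "b \<noteq> 0" "G1 = fps_const b * fps_X ^ n"
    using letters_are_monomials[of F1 G1] deg1 m n char_m char_n by metis
  \<comment> \<open>Conjugation by \<open>l X\<close> multiplies the coefficient of \<open>X\<^sup>m\<close> by \<open>l\<close> to the power \<open>m - 1\<close>.\<close>
  obtain l where l: "l ^ (m - 1) = 1 / a" using nth_root_exists[of "m - 1" "1 / a"] m by auto
  have l0: "l \<noteq> 0" using l a(1) m by (auto simp: power_0_left)
  define M where "M = fps_const l * (fps_X :: 'k fps)"
  define \<alpha> where "\<alpha> = b * l ^ (n - 1)"
  have M: "subdegree M = 1" using l0 unfolding M_def by (intro subdegreeI) auto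
  have LM: "subdegree (L oo M) = 1" using L(1) M subdegree_1_nth[OF M] by simp
  have "fps_conjugate (L oo M) F = fps_conjugate M F1" "fps_conjugate (L oo M) G = fps_conjugate M G1"
    using fps_conjugate_conjugate[OF L(1) M] F0 G0 by (simp_all add: F1_def G1_def)
  moreover have "fps_conjugate M F1 = fps_X ^ m"
    using fps_conjugate_scaling_monomial[OF l0, of m a] l a m by (simp add: M_def)
  moreover have "fps_conjugate M G1 = fps_const \<alpha> * fps_X ^ n"
    using fps_conjugate_scaling_monomial[OF l0, of n b] b n by (simp add: M_def \<alpha>_def)
  ultimately have F2: "fps_conjugate (L oo M) F = fps_X ^ m"
    and G2: "fps_conjugate (L oo M) G = fps_const \<alpha> * fps_X ^ n" by simp_all
  have \<alpha>: "\<alpha> \<noteq> 0" using b l0 by (simp add: \<alpha>_def)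
  have deg: "word_degree m n (x @ [LF]) = word_degree m n (y @ [LG])"
    using arg_cong[OF xy, of subdegree] unfolding subdegree_comp_word[OF F0 G0] F G .
  have "comp_word (fps_X ^ m) (fps_const \<alpha> * fps_X ^ n) (x @ [LF]) =
      comp_word (fps_X ^ m) (fps_const \<alpha> * fps_X ^ n) (y @ [LG])"
    using xy unfolding F2[symmetric] G2[symmetric] comp_word_conjugate[OF LM F0 G0] by simp
  then have "fps_const (\<alpha> ^ word_exponent m n (x @ [LF])) * fps_X ^ N =
      fps_const (\<alpha> ^ word_exponent m n (y @ [LG])) * (fps_X ^ N :: 'k fps)"
    using m n deg by (simp add: comp_word_monomials N_def del: fps_const_power)
  then have "\<alpha> ^ word_exponent m n (x @ [LF]) = \<alpha> ^ word_exponent m n (y @ [LG])"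
    by (simp del: fps_const_power)
  then have "\<exists>k>0. \<alpha> ^ k = 1"
    using \<alpha> word_exponent_neq[OF m n deg] by (intro root_of_unity_if_powers_eq)
  then show thesis using that LM F2 G2 \<alpha> by blast
qed

lemma root_of_unity_imp_equal_words:
  fixes \<alpha> :: "'a::field"
  assumes "m > 0" "n > 0" "k > 0" "\<alpha> ^ k = 1"
  obtains v w where "v \<noteq> []" "w \<noteq> []" "v \<noteq> w"
    "comp_word (fps_X ^ m) (fps_const \<alpha> * fps_X ^ n) v =
     comp_word (fps_X ^ m) (fps_const \<alpha> * fps_X ^ n) w"
proof -
  \<comment> \<open>The words with \<open>k\<close> letters \<open>G\<close> and one letter \<open>F\<close>, listed by the position of \<open>F\<close>.\<close>
  define wd where "wd i = replicate i LG @ [LF] @ replicate (k - i) LG" for i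
  have rep: "word_degree m n (replicate i LG) = n ^ i" for i by (induction i) simp_all
  have deg: "word_degree m n (wd i) = m * n ^ k" if "i \<le> k" for i
    using that by (simp add: wd_def word_degree_append rep flip: power_add)
  have wd_inj: "i = j" if "wd i = wd j" for i j
  proof -
    have "takeWhile ((=) LG) (wd i) = replicate i LG" for i
      by (simp add: wd_def takeWhile_append)
    then have "replicate i LG = replicate j LG" using that by metis
    then show ?thesis by simp
  qed
  define e where "e i = word_exponent m n (wd i) mod k" for i
  have "e ` {..k} \<subseteq> {..<k}" using assms(3) by (auto simp: e_def)
  then have "card (e ` {..k}) < card {..k}"
    using card_mono[of "{..<k}" "e ` {..k}"] by simp
  then have "\<not> inj_on e {..k}" by (rule pigeonhole)
  then obtain i j where ij: "i \<le> k" "j \<le> k" "i \<noteq> j" "e i = e j" by (auto simp: inj_on_def)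
  have red: "\<alpha> ^ word_exponent m n (wd i) = \<alpha> ^ e i" for i
  proof -
    have "\<alpha> ^ word_exponent m n (wd i) =
        \<alpha> ^ (k * (word_exponent m n (wd i) div k) + word_exponent m n (wd i) mod k)" by simp
    also have "\<dots> = \<alpha> ^ e i" unfolding power_add power_mult assms(4) e_def by simp
    finally show ?thesis .
  qed
  show thesis
  proof (rule that)
    show "comp_word (fps_X ^ m) (fps_const \<alpha> * fps_X ^ n) (wd i) =
        comp_word (fps_X ^ m) (fps_const \<alpha> * fps_X ^ n) (wd j)"
      unfolding comp_word_monomials[OF assms(1,2)] red using ij by (simp add: deg)
    show "wd i \<noteq> wd j" using ij(3) wd_inj by blast
  qed (simp_all add: wd_def)
qed

theorem theorem1p6:
  fixes F G :: "'k::alg_closed_field fps" and m n :: nat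
  assumes "subdegree F = m" and "subdegree G = n"
    and "m > 1" and "n > 1"
    and "\<not> CHAR('k) dvd m * n"
  shows "\<not> free_on_letters F G \<longleftrightarrow>
    (\<exists>L :: 'k fps. subdegree L = 1 \<and>
       fps_inv L oo F oo L = fps_X ^ m \<and>
       (\<exists>\<alpha> :: 'k. \<alpha> \<noteq> 0 \<and> (\<exists>k>0. \<alpha> ^ k = 1) \<and>
          fps_inv L oo G oo L = fps_const \<alpha> * fps_X ^ n))"
proof -
  have F0: "F $ 0 = 0" and G0: "G $ 0 = 0" using assms by (auto intro: nth_less_subdegree_zero)
  note free = free_on_letters_iff[OF F0 G0]
  show ?thesis unfolding fps_conjugate_def[symmetric]
  proof
    assume "\<not> free_on_letters F G"
    then obtain v w where "comp_word F G v = comp_word F G w" "v \<noteq> w" unfolding free by blast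
    from not_free_imp_conjugate_monomials[OF assms this]
    show "\<exists>L. subdegree L = 1 \<and> fps_conjugate L F = fps_X ^ m \<and>
      (\<exists>\<alpha>. \<alpha> \<noteq> 0 \<and> (\<exists>k>0. \<alpha> ^ k = 1) \<and> fps_conjugate L G = fps_const \<alpha> * fps_X ^ n)"
      by metis
  next
    assume "\<exists>L. subdegree L = 1 \<and> fps_conjugate L F = fps_X ^ m \<and>
      (\<exists>\<alpha>. \<alpha> \<noteq> 0 \<and> (\<exists>k>0. \<alpha> ^ k = 1) \<and> fps_conjugate L G = fps_const \<alpha> * fps_X ^ n)"
    then obtain L \<alpha> k where L: "subdegree L = 1" and F: "fps_conjugate L F = fps_X ^ m"
      and k: "k > 0" "\<alpha> ^ k = 1" and G: "fps_conjugate L G = fps_const \<alpha> * fps_X ^ n" by blast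
    obtain v w where vw: "v \<noteq> []" "w \<noteq> []" "v \<noteq> w"
      and "comp_word (fps_conjugate L F) (fps_conjugate L G) v =
        comp_word (fps_conjugate L F) (fps_conjugate L G) w"
      using root_of_unity_imp_equal_words[of m n k \<alpha>] assms k unfolding F G by auto
    then have "fps_conjugate L (comp_word F G v) = fps_conjugate L (comp_word F G w)"
      unfolding comp_word_conjugate[OF L F0 G0] by blast
    then have "comp_word F G v = comp_word F G w"
      using fps_conjugate_inj[OF L] comp_word_nth_0[OF F0 G0] by blast
    then show "\<not> free_on_letters F G" unfolding free using vw by blast
  qed
qed

end
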